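(* Let $(K,v)$ be a valued field with value group $\Gamma=v(K^* )$. Let $a\in K$ and $\delta,\epsilon\in\bigcup_{S\in\mathrm{Init}(I)}\mathbb R^{I_S}_{\mathrm{lex}}$, where $I=\mathrm{Prin}(\Gamma)$. The depth-zero valuations $\omega_{a,\delta}$ and $\omega_{a,\epsilon}$ on $K[x]$ are equivalent if and only if $\delta\sim_{\mathrm{sme}}\epsilon$.
   Context: Ordered sets are totally ordered; ordered groups are totally ordered abelian groups; embeddings strictly preserve order. Setting. $\Gamma_{\mathbb Q}=\Gamma\otimes_{\mathbb Z}\mathbb Q$ is the divisible hull. $I=\mathrm{Prin}(\Gamma)=\mathrm{Prin}(\Gamma_{\mathbb Q})$ is the set of non-zero principal convex subgroups (convex subgroups generated by one element), ordered by decreasing inclusion. For $i\in I$, $H_i\subset\Gamma_{\mathbb Q}$ is the corresponding subgroup, $H_i^*$ is the largest convex subgroup properly contained in $H_i$, and $Q_i=H_i/H_i^*$. For an ordered set $J$, $\mathbb R^J_{\mathrm{lex}}$ is the Hahn product: elements of $\mathbb R^J$ with well-ordered support, ordered lexicographically; $(\prod_{i\in I}Q_i)_{\mathrm{lex}}$ is defined similarly. Fix ordered-group embeddings $Q_i\hookrightarrow\mathbb R$ and (Hahn's theorem) an immediate embedding $\Gamma_{\mathbb Q}\hookrightarrow(\prod_{i\in I}Q_i)_{\mathrm{lex}}$, i.e. an ordered-group embedding such that an element generating $H_i$ as a convex subgroup has image with zero coordinates at all $j<i$ and $i$-th coordinate its class in $Q_i$. Identify $\Gamma\subset\Gamma_{\mathbb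 Q}\subset\mathbb R^I_{\mathrm{lex}}$. $\mathrm{Init}(I)$ is the set of initial segments of $I$ (including $\emptyset$ and $I$). $\mathbb I=I\sqcup\{i_S\mid S\in\mathrm{Init}(I)\}$ with the total order extending that of $I$ such that $S<i_S<I\setminus S$, and $i_S<i_T\Leftrightarrow S\subsetneq T$. $I_S=I\cup\{i_S\}\subset\mathbb I$. Regard $\mathbb R^I_{\mathrm{lex}}\subset\mathbb R^{I_S}_{\mathrm{lex}}\subset\mathbb R^{\mathbb I}_{\mathrm{lex}}$ via extension by zero. $\beta\sim_{\mathrm{sme}}\gamma$ (for $\beta,\gamma\in\mathbb R^{\mathbb I}_{\mathrm{lex}}$) means that there is an isomorphism of ordered groups $\langle\Gamma,\beta\rangle\to\langle\Gamma,\gamma\rangle$ which is the identity on $\Gamma$ and sends $\beta$ to $\gamma$. Valuations. A valuation on a commutative ring $A$ is a map $\mu:A\to\Lambda\cup\{\infty\}$, $\Lambda$ an ordered group, with $\mu(1)=0$, $\mu(0)=\infty$, $\mu(ab)=\mu(a)+\mu(b)$, $\mu(a+b)\ge\min\{\mu(a),\mu(b)\}$. Its value group $\Gamma_\mu$ is the subgroup of $\Lambda$ generated by the finite values of $\mu$. Valuations $\mu,\nu$ on $A$ are equivalent if there is an isomorphism of ordered groups $\varphi:\Gamma_\mu\to\Gamma_\nu$ with $\nu=\varphi\circ\mu$ (with $\varphi(\infty)=\infty$). For $a\in K$ and $\delta\in\bigcup_S\mathbb R^{I_S}_{\mathrm{lex}}$, the depth-zero valuation $\omega_{a,\delta}$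 on $K[x]$ is $\omega_{a,\delta}\big(\sum_{s\ge0}a_s(x-a)^s\big)=\min\{v(a_s)+s\delta\mid s\ge0\}$ ($a_s\in K$). *)

theory Defs
  imports
    "HOL-Library.Set_Algebras"
    "HOL-Computational_Algebra.Group_Closure"
    "HOL-Computational_Algebra.Polynomial"
begin

section \<open>Natural multiples in an additive monoid\<close>

primrec nmult :: "nat \<Rightarrow> 'a::comm_monoid_add \<Rightarrow> 'a" where
  "nmult 0 x = 0"
| "nmult (Suc n) x = x + nmult n x"

lemma nmult_zero [simp]: "nmult n 0 = 0"
  by (induction n) auto

lemma nmult_1 [simp]: "nmult (Suc 0) x = x"
  by simp

lemma nmult_add_left: "nmult (m + n) x = nmult m x + nmult n x"
  by (induction m) (auto simp: ac_simps)

lemma nmult_add_right: "nmult n (x + y) = nmult n x + nmult n y"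
  by (induction n) (auto simp: ac_simps)

lemma nmult_mult: "nmult (m * n) x = nmult m (nmult n x)"
  by (induction m) (auto simp: nmult_add_left)

lemma nmult_left_commute: "nmult m (nmult n x) = nmult n (nmult m x)"
  by (simp add: nmult_mult [symmetric] mult.commute)

lemma nmult_minus: "nmult n (- x) = - nmult n (x::'a::ab_group_add)"
  by (induction n) auto

lemma nmult_strict_mono:
  "0 < n \<Longrightarrow> x < y \<Longrightarrow> nmult n x < nmult n (y::'a::linordered_ab_group_add)"
proof (induction n)
  case (Suc n)
  then show ?case by (cases n) (auto intro: add_strict_mono)
qed simp

lemma nmult_le_iff:
  "0 < n \<Longrightarrow> nmult n x \<le> nmult n y \<longleftrightarrow> x \<le> (y::'a::linordered_ab_group_add)"
  by (metis linorder_not_le nmult_strict_mono order.order_iff_strict)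

lemma nmult_eq_iff:
  "0 < n \<Longrightarrow> nmult n x = nmult n y \<longleftrightarrow> x = (y::'a::linordered_ab_group_add)"
  by (metis nmult_le_iff order_antisym order_refl)


section \<open>The divisible hull\<close>

text \<open>
  For an abelian group \<open>\<Gamma>\<close> the tensor product of \<open>\<Gamma>\<close> with the rationals is the localisation of
  \<open>\<Gamma>\<close> at the positive integers. As \<open>\<Gamma>\<close> is ordered, it is torsion free, and therefore the
  fractions \<open>x / m\<close> and \<open>y / n\<close> agree iff \<open>n x = m y\<close>.
\<close>

definition frac_rel :: "'a::linordered_ab_group_add \<times> nat \<Rightarrow> 'a \<times> nat \<Rightarrow> bool" where
  "frac_rel p q \<longleftrightarrow> 0 < snd p \<and> 0 < snd q \<and> nmult (snd q) (fst p) = nmult (snd p) (fst q)"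

lemma frac_rel_part_equivp: "part_equivp frac_rel"
proof (rule part_equivpI)
  show "\<exists>p::'a \<times> nat. frac_rel p p"
    by (rule exI [of _ "(0, 1)"]) (simp add: frac_rel_def)
  show "symp (frac_rel :: 'a \<times> nat \<Rightarrow> _)"
    by (auto simp: symp_def frac_rel_def)
  show "transp (frac_rel :: 'a \<times> nat \<Rightarrow> _)"
  proof (rule transpI)
    fix p q r :: "'a \<times> nat"
    assume *: "frac_rel p q" "frac_rel q r"
    have "nmult (snd q) (nmult (snd r) (fst p)) = nmult (snd q) (nmult (snd p) (fst r))"
      using * unfolding frac_rel_def by (metis nmult_left_commute)
    then show "frac_rel p r"
      using * by (simp add: frac_rel_def nmult_eq_iff)
  qed
qed

quotient_type (overloaded) 'a divhull = "'a::linordered_ab_group_add \<times> nat" / partial: frac_rel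
  by (rule frac_rel_part_equivp)

instantiation divhull :: (linordered_ab_group_add) linordered_ab_group_add
begin

lift_definition zero_divhull :: "'a divhull" is "(0, 1)"
  by (simp add: frac_rel_def)

lift_definition plus_divhull :: "'a divhull \<Rightarrow> 'a divhull \<Rightarrow> 'a divhull"
  is "\<lambda>p q. (nmult (snd q) (fst p) + nmult (snd p) (fst q), snd p * snd q)"
proof -
  fix p p' q q' :: "'a \<times> nat"
  assume *: "frac_rel p p'" "frac_rel q q'"
  then have "nmult (snd q * snd q') (nmult (snd p') (fst p)) = nmult (snd q * snd q') (nmult (snd p) (fst p'))"
    and "nmult (snd p * snd p') (nmult (snd q') (fst q)) = nmult (snd p * snd p') (nmult (snd q) (fst q'))"
    by (simp_all add: frac_rel_def)
  then show "frac_rel (nmult (snd q) (fst p) + nmult (snd p) (fst q), snd p * snd q)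
      (nmult (snd q') (fst p') + nmult (snd p') (fst q'), snd p' * snd q')"
    using * by (simp add: frac_rel_def nmult_add_right nmult_mult [symmetric] ac_simps)
qed

lift_definition uminus_divhull :: "'a divhull \<Rightarrow> 'a divhull" is "\<lambda>p. (- fst p, snd p)"
  by (simp add: frac_rel_def nmult_minus)

definition minus_divhull :: "'a divhull \<Rightarrow> 'a divhull \<Rightarrow> 'a divhull" where
  "minus_divhull x y = x + - y"

lift_definition less_eq_divhull :: "'a divhull \<Rightarrow> 'a divhull \<Rightarrow> bool"
  is "\<lambda>p q. nmult (snd q) (fst p) \<le> nmult (snd p) (fst q)"
proof -
  fix p p' q q' :: "'a \<times> nat"
  assume *: "frac_rel p p'" "frac_rel q q'"
  let ?N = "snd p' * snd q'" and ?M = "snd p * snd q"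
  have "nmult (snd q * snd q') (nmult (snd p') (fst p)) = nmult (snd q * snd q') (nmult (snd p) (fst p'))"
    "nmult (snd p * snd p') (nmult (snd q') (fst q)) = nmult (snd p * snd p') (nmult (snd q) (fst q'))"
    using * by (simp_all add: frac_rel_def)
  then have "nmult ?N (nmult (snd q) (fst p)) = nmult ?M (nmult (snd q') (fst p'))"
    "nmult ?N (nmult (snd p) (fst q)) = nmult ?M (nmult (snd p') (fst q'))"
    by (simp_all add: nmult_mult [symmetric] ac_simps)
  moreover have "0 < ?N" "0 < ?M"
    using * by (auto simp: frac_rel_def)
  ultimately show "(nmult (snd q) (fst p) \<le> nmult (snd p) (fst q)) =
      (nmult (snd q') (fst p') \<le> nmult (snd p') (fst q'))"
    by (metis nmult_le_iff)
qed

definition less_divhull :: "'a divhull \<Rightarrow> 'a divhull \<Rightarrow> bool" where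
  "less_divhull x y \<longleftrightarrow> x \<le> y \<and> \<not> y \<le> x"

instance
proof
  fix x y z :: "'a divhull"
  show "x + y + z = x + (y + z)"
    by transfer (simp add: frac_rel_def nmult_add_right nmult_mult [symmetric] ac_simps)
  show "x + y = y + x"
    by transfer (simp add: frac_rel_def nmult_mult [symmetric] ac_simps)
  show "0 + x = x"
    by transfer (simp add: frac_rel_def)
  show "- x + x = 0"
    by transfer (simp add: frac_rel_def nmult_minus)
  show "x - y = x + - y"
    by (rule minus_divhull_def)
  show "x < y \<longleftrightarrow> x \<le> y \<and> \<not> y \<le> x"
    by (rule less_divhull_def)
  show "x \<le> x"
    by transfer simp
  show "x \<le> z" if "x \<le> y" "y \<le> z"
    using that
  proof transfer
    fix p q r :: "'a \<times> nat"
    assume pos: "frac_rel p p" "frac_rel q q" "frac_rel r r"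
      and le: "nmult (snd q) (fst p) \<le> nmult (snd p) (fst q)"
        "nmult (snd r) (fst q) \<le> nmult (snd q) (fst r)"
    have "nmult (snd r) (nmult (snd q) (fst p)) \<le> nmult (snd r) (nmult (snd p) (fst q))"
      using le pos by (simp add: frac_rel_def nmult_le_iff)
    also have "\<dots> = nmult (snd p) (nmult (snd r) (fst q))"
      by (rule nmult_left_commute)
    also have "\<dots> \<le> nmult (snd p) (nmult (snd q) (fst r))"
      using le pos by (simp add: frac_rel_def nmult_le_iff)
    finally have "nmult (snd q) (nmult (snd r) (fst p)) \<le> nmult (snd q) (nmult (snd p) (fst r))"
      by (metis nmult_left_commute)
    then show "nmult (snd r) (fst p) \<le> nmult (snd p) (fst r)"
      using pos by (simp add: frac_rel_def nmult_le_iff)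
  qed
  show "x = y" if "x \<le> y" "y \<le> x"
    using that by transfer (auto simp: frac_rel_def)
  show "x \<le> y \<or> y \<le> x"
    by transfer auto
  show "z + x \<le> z + y" if "x \<le> y"
    using that
  proof transfer
    fix p q r :: "'a \<times> nat"
    assume pos: "frac_rel p p" "frac_rel q q" "frac_rel r r"
      and le: "nmult (snd q) (fst p) \<le> nmult (snd p) (fst q)"
    have "nmult (snd r * snd r) (nmult (snd q) (fst p)) \<le> nmult (snd r * snd r) (nmult (snd p) (fst q))"
      using le pos by (simp add: frac_rel_def nmult_le_iff)
    then have "nmult (snd r * snd q) (nmult (snd r) (fst p)) \<le> nmult (snd r * snd p) (nmult (snd r) (fst q))"
      by (simp add: nmult_mult [symmetric] ac_simps)
    moreover have "nmult (snd r * snd q) (nmult (snd p) (fst r)) = nmult (snd r * snd p) (nmult (snd q) (fst r))"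
      by (simp add: nmult_mult [symmetric] ac_simps)
    ultimately show "nmult (snd (nmult (snd q) (fst r) + nmult (snd r) (fst q), snd r * snd q))
          (fst (nmult (snd p) (fst r) + nmult (snd r) (fst p), snd r * snd p))
        \<le> nmult (snd (nmult (snd p) (fst r) + nmult (snd r) (fst p), snd r * snd p))
          (fst (nmult (snd q) (fst r) + nmult (snd r) (fst q), snd r * snd q))"
      by (simp add: nmult_add_right)
  qed
qed

end

lift_definition to_divhull :: "'a::linordered_ab_group_add \<Rightarrow> 'a divhull" is "\<lambda>x. (x, 1)"
  by (simp add: frac_rel_def)

lemma to_divhull_add: "to_divhull (x + y) = to_divhull x + to_divhull y"
  by transfer (simp add: frac_rel_def)

lemma to_divhull_le_iff: "to_divhull x \<le> to_divhull y \<longleftrightarrow> x \<le> y"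
  by transfer simp

lemma to_divhull_eq_iff: "to_divhull x = to_divhull y \<longleftrightarrow> x = y"
  by (simp add: order_eq_iff to_divhull_le_iff)

lemma to_divhull_less_iff: "to_divhull x < to_divhull y \<longleftrightarrow> x < y"
  by (simp add: to_divhull_le_iff less_le_not_le)

lemma ex_nmult_divhull: "\<exists>n>0. \<exists>g. nmult n x = to_divhull g"
proof -
  note eqI = Quotient_rel_abs [OF Quotient_divhull]
  have "nmult (snd p) (abs_divhull p) = to_divhull (fst p)" if "0 < snd p" for p :: "'a \<times> nat"
  proof -
    have "nmult k (abs_divhull p) = abs_divhull (nmult k (fst p), snd p)" for k
    proof (induction k)
      case 0
      have "abs_divhull (0, 1) = abs_divhull (0 :: 'a, snd p)"
        using that by (intro eqI) (simp add: frac_rel_def)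
      then show ?case
        by (simp add: zero_divhull.abs_eq)
    next
      case (Suc k)
      have "abs_divhull p + abs_divhull (nmult k (fst p), snd p)
          = abs_divhull (nmult (snd p) (fst p) + nmult (snd p) (nmult k (fst p)), snd p * snd p)"
        using that by (subst plus_divhull.abs_eq) (simp_all add: frac_rel_def)
      also have "\<dots> = abs_divhull (nmult (Suc k) (fst p), snd p)"
        using that by (intro eqI) (simp add: frac_rel_def nmult_add_right nmult_mult)
      finally show ?case
        using Suc by simp
    qed
    moreover have "abs_divhull (nmult (snd p) (fst p), snd p) = to_divhull (fst p)"
      unfolding to_divhull.abs_eq using that by (intro eqI) (simp add: frac_rel_def)
    ultimately show ?thesis by simp
  qed
  moreover obtain p where "x = abs_divhull p" "0 < snd p"
    using Quotient_abs_rep [OF Quotient_divhull] Quotient_rep_reflp [OF Quotient_divhull]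
    by (metis frac_rel_def)
  ultimately show ?thesis
    by metis
qed


section \<open>Convex subgroups and the index set \<open>I\<close>\<close>

definition convex_subgroup :: "'a::linordered_ab_group_add set \<Rightarrow> bool" where
  "convex_subgroup H \<longleftrightarrow>
    0 \<in> H \<and> (\<forall>x\<in>H. \<forall>y\<in>H. x - y \<in> H) \<and> (\<forall>x\<in>H. \<forall>y\<in>H. {x..y} \<subseteq> H)"

lemma convex_subgroup_uminus: "convex_subgroup H \<Longrightarrow> x \<in> H \<Longrightarrow> - x \<in> H"
  unfolding convex_subgroup_def by (metis diff_0)

lemma convex_subgroup_absorb:
  assumes "convex_subgroup H" "y \<in> H" "max x (- x) \<le> max y (- y)"
  shows "x \<in> H"
proof -
  let ?m = "max y (- y)"
  have "?m \<in> H"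
    using assms(1,2) by (simp add: max_def convex_subgroup_uminus)
  moreover have "- ?m \<in> H"
    using assms(1) calculation by (rule convex_subgroup_uminus)
  moreover have "x \<le> ?m" "- ?m \<le> x"
    using assms(3) by (simp_all only: max.bounded_iff minus_le_iff [of _ x])
  ultimately show ?thesis
    using assms(1) unfolding convex_subgroup_def by (meson atLeastAtMost_iff subsetD)
qed

lemma convex_subgroup_linear:
  assumes "convex_subgroup G" "convex_subgroup H"
  shows "G \<subseteq> H \<or> H \<subseteq> G"
  using convex_subgroup_absorb [OF assms(1)] convex_subgroup_absorb [OF assms(2)]
  by (meson linear subsetI)

lemma convex_subgroup_Inter: "(\<And>H. H \<in> \<H> \<Longrightarrow> convex_subgroup H) \<Longrightarrow> convex_subgroup (\<Inter>\<H>)"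
  by (fastforce simp: convex_subgroup_def)

lemma convex_subgroup_hull: "convex_subgroup (convex_subgroup hull S)"
  by (rule hull_in) (auto intro: convex_subgroup_Inter)

lemma convex_subgroup_singleton_0: "convex_subgroup {0}"
  by (auto simp: convex_subgroup_def)

definition Prin :: "'a::linordered_ab_group_add set set" where
  "Prin = {convex_subgroup hull {x} |x. True} - {{0}}"

text \<open>
  \<open>Prin\<close> is ordered by decreasing inclusion: \<open>i\<close> precedes \<open>j\<close> iff \<open>j \<subset> i\<close>.
\<close>

definition Init :: "'a::linordered_ab_group_add set set set" where
  "Init = {S. S \<subseteq> Prin \<and> (\<forall>i\<in>S. \<forall>j\<in>Prin. i \<subseteq> j \<longrightarrow> j \<in> S)}"

lemma Prin_linear: "i \<in> Prin \<Longrightarrow> j \<in> Prin \<Longrightarrow> i \<subseteq> j \<or> j \<subseteq> i"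
  using convex_subgroup_linear convex_subgroup_hull unfolding Prin_def by blast

lemma Init_up: "S \<in> Init \<Longrightarrow> i \<in> S \<Longrightarrow> j \<in> Prin \<Longrightarrow> i \<subseteq> j \<Longrightarrow> j \<in> S"
  by (auto simp: Init_def)

lemma Init_linear: "S \<in> Init \<Longrightarrow> T \<in> Init \<Longrightarrow> S \<subseteq> T \<or> T \<subseteq> S"
proof (rule ccontr)
  assume ST: "S \<in> Init" "T \<in> Init" and "\<not> (S \<subseteq> T \<or> T \<subseteq> S)"
  then obtain i j where ij: "i \<in> S" "i \<notin> T" "j \<in> T" "j \<notin> S"
    by blast
  then have "i \<in> Prin" "j \<in> Prin"
    using ST by (auto simp: Init_def)
  with Prin_linear [of i j] Init_up [of S i j] Init_up [of T j i] ST ij show False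
    by blast
qed


section \<open>The ordered set obtained by adding a point \<open>i\<^sub>S\<close> for each initial segment \<open>S\<close>\<close>

text \<open>
  \<open>Cut S\<close> stands for \<open>i\<^sub>S\<close>: it lies above the elements of \<open>S\<close> and below the elements of \<open>I - S\<close>.
  The index set \<open>I\<close> may be empty, but the extended one always contains \<open>Cut {}\<close>, so it forms a type.
\<close>

datatype 'i cut_point = Pt 'i | Cut "'i set"

typedef (overloaded) 'g ext_index =
  "Pt ` Prin \<union> Cut ` Init :: 'g::linordered_ab_group_add set cut_point set"
  by (rule exI [of _ "Cut {}"]) (simp add: Init_def)

setup_lifting type_definition_ext_index

instantiation ext_index :: (linordered_ab_group_add) linorder
begin

lift_definition less_eq_ext_index :: "'a ext_index \<Rightarrow> 'a ext_index \<Rightarrow> bool" is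
  "\<lambda>p q. case p of
     Pt i \<Rightarrow> (case q of Pt j \<Rightarrow> j \<subseteq> i | Cut S \<Rightarrow> i \<in> S)
   | Cut S \<Rightarrow> (case q of Pt j \<Rightarrow> j \<notin> S | Cut T \<Rightarrow> S \<subseteq> T)" .

definition less_ext_index :: "'a ext_index \<Rightarrow> 'a ext_index \<Rightarrow> bool" where
  "less_ext_index p q \<longleftrightarrow> p \<le> q \<and> \<not> q \<le> p"

instance
proof
  fix p q r :: "'a ext_index"
  show "p < q \<longleftrightarrow> p \<le> q \<and> \<not> q \<le> p"
    by (rule less_ext_index_def)
  show "p \<le> p"
    by transfer (auto split: cut_point.split)
  show "p \<le> r" if "p \<le> q" "q \<le> r"
    using that
  proof transfer
    fix p q r :: "'a set cut_point"
    assume in_idx: "p \<in> Pt ` Prin \<union> Cut ` Init" "q \<in> Pt ` Prin \<union> Cut ` Init"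
        "r \<in> Pt ` Prin \<union> Cut ` Init"
      and le: "case p of Pt i \<Rightarrow> (case q of Pt j \<Rightarrow> j \<subseteq> i | Cut S \<Rightarrow> i \<in> S)
         | Cut S \<Rightarrow> (case q of Pt j \<Rightarrow> j \<notin> S | Cut T \<Rightarrow> S \<subseteq> T)"
        "case q of Pt i \<Rightarrow> (case r of Pt j \<Rightarrow> j \<subseteq> i | Cut S \<Rightarrow> i \<in> S)
         | Cut S \<Rightarrow> (case r of Pt j \<Rightarrow> j \<notin> S | Cut T \<Rightarrow> S \<subseteq> T)"
    show "case p of Pt i \<Rightarrow> (case r of Pt j \<Rightarrow> j \<subseteq> i | Cut S \<Rightarrow> i \<in> S)
       | Cut S \<Rightarrow> (case r of Pt j \<Rightarrow> j \<notin> S | Cut T \<Rightarrow> S \<subseteq> T)"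
    proof (cases p; cases q; cases r)
      fix S i T assume "p = Cut S" "q = Pt i" "r = Cut T"
      then show ?thesis
        using in_idx le Init_linear [of S T] by auto
    next
      fix i S j assume "p = Pt i" "q = Cut S" "r = Pt j"
      then show ?thesis
        using in_idx le Init_up [of S i j] Prin_linear [of i j] by auto
    qed (use in_idx le Init_up in auto)
  qed
  show "p = q" if "p \<le> q" "q \<le> p"
    using that by transfer (auto split: cut_point.splits)
  show "p \<le> q \<or> q \<le> p"
    by transfer (auto split: cut_point.splits dest: Prin_linear Init_linear)
qed

end

text \<open>\<open>I\<close> and \<open>I\<^sub>S\<close> as subsets of the extended index set:\<close>

definition idx :: "'g::linordered_ab_group_add ext_index set" where
  "idx = {p. Rep_ext_index p \<in> Pt ` Prin}"

definition idx_cut :: "'g::linordered_ab_group_add set set \<Rightarrow> 'g ext_index set" where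
  "idx_cut S = {p. Rep_ext_index p \<in> insert (Cut S) (Pt ` Prin)}"


section \<open>Real Hahn products\<close>

typedef (overloaded) 'j hahn = "{f :: 'j::linorder \<Rightarrow> real. wfp_on {j. f j \<noteq> 0} (<)}"
  morphisms coord Abs_hahn
  by (rule exI [of _ "\<lambda>_. 0"]) (simp add: wfp_on_def)

setup_lifting type_definition_hahn

lemma wfp_on_Un:
  assumes "wfp_on A ((<) :: 'j::linorder \<Rightarrow> _)" "wfp_on B ((<) :: 'j \<Rightarrow> _)"
  shows "wfp_on (A \<union> B) ((<) :: 'j \<Rightarrow> _)"
  unfolding wfp_on_iff_ex_minimal
proof (intro allI impI)
  fix C assume C: "C \<subseteq> A \<union> B" "C \<noteq> {}"
  have least: "\<exists>z\<in>C \<inter> D. \<forall>y\<in>C \<inter> D. z \<le> y"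
    if D: "wfp_on D ((<) :: 'j \<Rightarrow> _)" "C \<inter> D \<noteq> {}" for D
  proof -
    from D obtain z where "z \<in> C \<inter> D" "\<forall>y. y < z \<longrightarrow> y \<notin> C \<inter> D"
      unfolding wfp_on_iff_ex_minimal by (meson inf_le2)
    then show ?thesis
      by (meson linorder_not_le)
  qed
  have "\<exists>z\<in>C. \<forall>y\<in>C. z \<le> y"
  proof (cases "C \<inter> A = {} \<or> C \<inter> B = {}")
    case True
    then consider "C \<inter> A = C" | "C \<inter> B = C"
      using C by blast
    then show ?thesis
      using least [OF assms(1)] least [OF assms(2)] C(2) by cases auto
  next
    case False
    then obtain a b where ab: "a \<in> C" "b \<in> C" "\<forall>y\<in>C \<inter> A. a \<le> y" "\<forall>y\<in>C \<inter> B. b \<le> y"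
      using least [OF assms(1)] least [OF assms(2)] by blast
    have "min a b \<in> C"
      using ab by (simp add: min_def)
    moreover have "min a b \<le> y" if "y \<in> C" for y
    proof -
      consider "y \<in> A" | "y \<in> B"
        using \<open>y \<in> C\<close> C(1) by blast
      then show ?thesis
        using ab \<open>y \<in> C\<close> by cases (auto simp: min_le_iff_disj)
    qed
    ultimately show ?thesis
      by blast
  qed
  then show "\<exists>z\<in>C. \<forall>y. y < z \<longrightarrow> y \<notin> C"
    by (meson linorder_not_le)
qed

instantiation hahn :: (linorder) linordered_ab_group_add
begin

lift_definition zero_hahn :: "'a hahn" is "\<lambda>_. 0"
  by (simp add: wfp_on_def)

lift_definition plus_hahn :: "'a hahn \<Rightarrow> 'a hahn \<Rightarrow> 'a hahn" is "\<lambda>f g j. f j + g j"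
  by (erule (1) wfp_on_subset [OF wfp_on_Un]) auto

lift_definition uminus_hahn :: "'a hahn \<Rightarrow> 'a hahn" is "\<lambda>f j. - f j"
  by simp

lift_definition minus_hahn :: "'a hahn \<Rightarrow> 'a hahn \<Rightarrow> 'a hahn" is "\<lambda>f g j. f j - g j"
  by (erule (1) wfp_on_subset [OF wfp_on_Un]) auto

lift_definition less_hahn :: "'a hahn \<Rightarrow> 'a hahn \<Rightarrow> bool" is
  "\<lambda>f g. \<exists>j. f j < g j \<and> (\<forall>k<j. f k = g k)" .

definition less_eq_hahn :: "'a hahn \<Rightarrow> 'a hahn \<Rightarrow> bool" where
  "less_eq_hahn f g \<longleftrightarrow> f = g \<or> f < g"

instance
proof
  fix f g h :: "'a hahn"
  show "f + g + h = f + (g + h)" by transfer (simp add: ac_simps)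
  show "f + g = g + f" by transfer (simp add: ac_simps)
  show "0 + f = f" by transfer simp
  show "- f + f = 0" by transfer simp
  show "f - g = f + - g" by transfer simp
  have irrefl: "\<not> f < f" for f :: "'a hahn"
    by transfer simp
  have trans: "f < h" if "f < g" "g < h" for f g h :: "'a hahn"
    using that
  proof transfer
    fix f g h :: "'a \<Rightarrow> real"
    assume "\<exists>j. f j < g j \<and> (\<forall>k<j. f k = g k)" "\<exists>j. g j < h j \<and> (\<forall>k<j. g k = h k)"
    then obtain i j where
      ij: "f i < g i" "\<forall>k<i. f k = g k" "g j < h j" "\<forall>k<j. g k = h k"
      by blast
    then have "f (min i j) < h (min i j)" "\<forall>k<min i j. f k = h k"
      by (cases i j rule: linorder_cases; auto simp: min_def)+
    then show "\<exists>j. f j < h j \<and> (\<forall>k<j. f k = h k)"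
      by blast
  qed
  show "f < g \<longleftrightarrow> f \<le> g \<and> \<not> g \<le> f"
    unfolding less_eq_hahn_def by (metis irrefl trans)
  show "f \<le> f"
    by (simp add: less_eq_hahn_def)
  show "f \<le> h" if "f \<le> g" "g \<le> h"
    using that unfolding less_eq_hahn_def by (metis trans)
  show "f = g" if "f \<le> g" "g \<le> f"
    using that unfolding less_eq_hahn_def by (metis irrefl trans)
  have "f = g \<or> f < g \<or> g < f"
  proof transfer
    fix f g :: "'a \<Rightarrow> real"
    assume "wfp_on {j. f j \<noteq> 0} (<)" "wfp_on {j. g j \<noteq> 0} (<)"
    then have wf: "wfp_on {j. f j \<noteq> g j} ((<) :: 'a \<Rightarrow> _)"
      by (rule wfp_on_subset [OF wfp_on_Un]) auto
    show "f = g \<or> (\<exists>j. f j < g j \<and> (\<forall>k<j. f k = g k)) \<or> (\<exists>j. g j < f j \<and> (\<forall>k<j. g k = f k))"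
    proof (cases "f = g")
      case False
      then have "{j. f j \<noteq> g j} \<noteq> {}"
        by auto
      with wf have "\<exists>z\<in>{j. f j \<noteq> g j}. \<forall>y. y < z \<longrightarrow> y \<notin> {j. f j \<noteq> g j}"
        unfolding wfp_on_iff_ex_minimal by (elim allE [of _ "{j. f j \<noteq> g j}"]) simp
      then obtain j where "f j \<noteq> g j" "\<forall>k<j. f k = g k"
        by auto
      then show ?thesis
        by (metis linorder_neqE)
    qed simp
  qed
  then show "f \<le> g \<or> g \<le> f"
    by (auto simp: less_eq_hahn_def)
  have "h + f < h + g" if "f < g"
    using that by transfer simp
  then show "h + f \<le> h + g" if "f \<le> g"
    using that by (auto simp: less_eq_hahn_def)
qed

end

definition supported_on :: "'j::linorder set \<Rightarrow> 'j hahn set" where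
  "supported_on J = {f. {j. coord f j \<noteq> 0} \<subseteq> J}"


section \<open>Immediate embeddings of the divisible hull\<close>

text \<open>For \<open>i\<close> in \<open>Prin\<close>, the subgroup \<open>prin_hull i\<close> of the divisible hull corresponding to \<open>i\<close>.\<close>

definition prin_hull :: "'g::linordered_ab_group_add set \<Rightarrow> 'g divhull set" where
  "prin_hull i = convex_subgroup hull (to_divhull ` i)"

lemma nmult_convex_subgroup: "convex_subgroup H \<Longrightarrow> x \<in> H \<Longrightarrow> nmult n x \<in> H"
proof (induction n)
  case (Suc n)
  then have "- nmult n x \<in> H"
    by (simp add: convex_subgroup_uminus)
  with Suc.prems have "x - (- nmult n x) \<in> H"
    unfolding convex_subgroup_def by blast
  then show ?case by simp
qed (simp add: convex_subgroup_def)

lemma nmult_convex_subgroup_iff: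
  assumes "convex_subgroup H" "0 < n"
  shows "nmult n x \<in> H \<longleftrightarrow> x \<in> H"
proof
  have pos: "y \<le> nmult n y" if "0 \<le> y" for y :: 'a
  proof -
    have "0 \<le> nmult k y" for k
      using that by (induction k) auto
    with \<open>0 < n\<close> show ?thesis
      by (cases n) auto
  qed
  assume n: "nmult n x \<in> H"
  then have "nmult n (- x) \<in> H"
    using assms(1) by (simp add: nmult_minus convex_subgroup_uminus)
  then have *: "{0..nmult n x} \<subseteq> H" "{0..nmult n (- x)} \<subseteq> H"
    using n assms(1) unfolding convex_subgroup_def by blast+
  show "x \<in> H"
  proof (cases "0 \<le> x")
    case True
    with *(1) pos [of x] show ?thesis by auto
  next
    case False
    with *(2) pos [of "- x"] have "- x \<in> H" by auto
    with convex_subgroup_uminus [OF assms(1), of "- x"] show ?thesis by simp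
  qed
qed (simp add: nmult_convex_subgroup assms(1))

lemma to_divhull_0: "to_divhull 0 = 0"
  by (simp add: to_divhull.abs_eq zero_divhull.abs_eq)

lemma to_divhull_minus: "to_divhull (- x) = - to_divhull x"
  using minus_unique [of "to_divhull x" "to_divhull (- x)"]
  by (simp add: to_divhull_0 flip: to_divhull_add)

lemma to_divhull_diff: "to_divhull (x - y) = to_divhull x - to_divhull y"
  using to_divhull_add [of x "- y"] by (simp add: to_divhull_minus)

lemma to_divhull_nmult: "to_divhull (nmult n x) = nmult n (to_divhull x)"
  by (induction n) (auto simp: to_divhull_0 to_divhull_add)

lemma prin_hull_hull: "prin_hull (convex_subgroup hull {x}) = convex_subgroup hull {to_divhull x}"
proof
  define D where "D = convex_subgroup hull {to_divhull x}"
  have x: "to_divhull x \<in> D"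
    by (simp add: D_def hull_inc)
  note D = convex_subgroup_hull [of "{to_divhull x}", folded D_def, unfolded convex_subgroup_def]
  have "convex_subgroup {y. to_divhull y \<in> D}"
    unfolding convex_subgroup_def
  proof (intro conjI ballI subsetI)
    show "0 \<in> {y. to_divhull y \<in> D}"
      using D by (simp add: to_divhull_0)
  next
    fix y z assume "y \<in> {y. to_divhull y \<in> D}" "z \<in> {y. to_divhull y \<in> D}"
    then show "y - z \<in> {y. to_divhull y \<in> D}"
      using D by (simp add: to_divhull_diff)
  next
    fix y z w assume "y \<in> {y. to_divhull y \<in> D}" "z \<in> {y. to_divhull y \<in> D}" "w \<in> {y..z}"
    then have "{to_divhull y..to_divhull z} \<subseteq> D" "to_divhull w \<in> {to_divhull y..to_divhull z}"
      using D by (simp_all add: to_divhull_le_iff)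
    then show "w \<in> {y. to_divhull y \<in> D}"
      by blast
  qed
  then have "convex_subgroup hull {x} \<subseteq> {y. to_divhull y \<in> D}"
    by (intro hull_minimal) (simp_all add: x)
  then show "prin_hull (convex_subgroup hull {x}) \<subseteq> convex_subgroup hull {to_divhull x}"
    unfolding prin_hull_def D_def by (intro hull_minimal convex_subgroup_hull) blast
  show "convex_subgroup hull {to_divhull x} \<subseteq> prin_hull (convex_subgroup hull {x})"
    unfolding prin_hull_def by (intro hull_mono) (simp add: hull_inc)
qed

lemma prin_hull_Int:
  assumes "convex_subgroup i"
  shows "to_divhull g \<in> prin_hull i \<longleftrightarrow> g \<in> i"
proof
  define C where "C = {q. \<exists>n>0. \<exists>g\<in>i. nmult n q = to_divhull g}"
  have common: "\<exists>n>0. \<exists>g\<in>i. \<exists>h\<in>i. nmult n p = to_divhull g \<and> nmult n q = to_divhull h"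
    if pq: "p \<in> C" "q \<in> C" for p q
  proof -
    from pq obtain m n g h where *: "0 < m" "0 < n" "g \<in> i" "h \<in> i"
        "nmult m p = to_divhull g" "nmult n q = to_divhull h"
      unfolding C_def by blast
    have "nmult (m * n) p = to_divhull (nmult n g)" "nmult (m * n) q = to_divhull (nmult m h)"
      using * by (simp_all add: nmult_mult nmult_left_commute [of m n] to_divhull_nmult)
    then show ?thesis
      using * assms by (metis mult_pos_pos nmult_convex_subgroup)
  qed
  have "convex_subgroup C"
    unfolding convex_subgroup_def
  proof (intro conjI ballI subsetI)
    show "0 \<in> C"
      using assms unfolding C_def convex_subgroup_def by (force simp: to_divhull_0)
  next
    fix p q assume "p \<in> C" "q \<in> C"
    from common [OF this] obtain n g h where *: "0 < n" "g \<in> i" "h \<in> i"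
      "nmult n p = to_divhull g" "nmult n q = to_divhull h" by blast
    have "nmult n (p - q) = to_divhull (g - h)"
      using * nmult_add_right [of n p "- q"] by (simp add: nmult_minus to_divhull_diff)
    moreover have "g - h \<in> i"
      using * assms by (simp add: convex_subgroup_def)
    ultimately show "p - q \<in> C"
      using * unfolding C_def by blast
  next
    fix p q z assume "p \<in> C" "q \<in> C" and z: "z \<in> {p..q}"
    from common [OF this(1,2)] obtain n g h where *: "0 < n" "g \<in> i" "h \<in> i"
      "nmult n p = to_divhull g" "nmult n q = to_divhull h" by blast
    obtain m k where k: "0 < m" "nmult m z = to_divhull k"
      using ex_nmult_divhull by blast
    have "nmult (m * n) p \<le> nmult (m * n) z" "nmult (m * n) z \<le> nmult (m * n) q"
      using z * k by (simp_all add: nmult_le_iff)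
    moreover have "nmult (m * n) p = to_divhull (nmult m g)" "nmult (m * n) q = to_divhull (nmult m h)"
        "nmult (m * n) z = to_divhull (nmult n k)"
      using * k by (simp_all add: nmult_mult nmult_left_commute [of m n z] to_divhull_nmult)
    ultimately have "nmult m g \<le> nmult n k" "nmult n k \<le> nmult m h"
      by (simp_all add: to_divhull_le_iff)
    then have "nmult n k \<in> i"
      using * assms nmult_convex_subgroup [OF assms] unfolding convex_subgroup_def
      by (meson atLeastAtMost_iff subsetD)
    then show "z \<in> C"
      using \<open>nmult (m * n) z = _\<close> * k unfolding C_def by (metis (mono_tags, lifting) mem_Collect_eq mult_pos_pos)
  qed
  moreover have "to_divhull ` i \<subseteq> C"
    unfolding C_def by (force intro: exI [of _ 1])
  ultimately have "prin_hull i \<subseteq> C"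
    unfolding prin_hull_def by (intro hull_minimal)
  moreover assume "to_divhull g \<in> prin_hull i"
  ultimately obtain n h where "0 < n" "h \<in> i" "to_divhull (nmult n g) = to_divhull h"
    unfolding C_def by (auto simp: to_divhull_nmult)
  then show "g \<in> i"
    using nmult_convex_subgroup_iff [OF assms] by (metis to_divhull_eq_iff)
qed (auto simp: prin_hull_def intro: hull_inc)

lemma Prin_convex_subgroup: "i \<in> Prin \<Longrightarrow> convex_subgroup i"
  by (auto simp: Prin_def intro: convex_subgroup_hull)

lemma hull_eq_singleton_0_iff: "convex_subgroup hull {x} = {0} \<longleftrightarrow> x = 0"
  by (metis convex_subgroup_singleton_0 hull_inc hull_same insertI1 singletonD)

lemma Prin_altdef: "Prin = {convex_subgroup hull {x} |x. x \<noteq> 0}"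
  unfolding Prin_def using hull_eq_singleton_0_iff by blast

text \<open>
  Passing to the divisible hull identifies the principal convex subgroups of both groups, and this
  identification respects inclusion.
\<close>

lemma prin_hull_subset_iff: "i \<in> Prin \<Longrightarrow> j \<in> Prin \<Longrightarrow> prin_hull i \<subseteq> prin_hull j \<longleftrightarrow> i \<subseteq> j"
proof
  assume *: "i \<in> Prin" "j \<in> Prin" "prin_hull i \<subseteq> prin_hull j"
  show "i \<subseteq> j"
    using * by (auto simp flip: prin_hull_Int [OF Prin_convex_subgroup])
qed (auto simp: prin_hull_def intro!: hull_mono)

lemma bij_betw_prin_hull: "bij_betw prin_hull Prin (Prin :: 'g::linordered_ab_group_add divhull set set)"
  unfolding bij_betw_def
proof
  show "inj_on prin_hull (Prin :: 'g set set)"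
    by (rule inj_onI) (metis order_antisym order_refl prin_hull_subset_iff)
  show "prin_hull ` Prin = (Prin :: 'g divhull set set)"
  proof
    show "prin_hull ` Prin \<subseteq> (Prin :: 'g divhull set set)"
    proof
      fix c :: "'g divhull set" assume "c \<in> prin_hull ` Prin"
      then obtain g :: 'g where "g \<noteq> 0" "c = convex_subgroup hull {to_divhull g}"
        by (auto simp: Prin_altdef prin_hull_hull)
      moreover have "to_divhull g \<noteq> 0"
        using \<open>g \<noteq> 0\<close> to_divhull_eq_iff [of g 0] by (simp add: to_divhull_0)
      ultimately show "c \<in> Prin"
        unfolding Prin_altdef by blast
    qed
    show "(Prin :: 'g divhull set set) \<subseteq> prin_hull ` Prin"
    proof
      fix c :: "'g divhull set" assume "c \<in> Prin"
      then obtain q where q: "q \<noteq> 0" "c = convex_subgroup hull {q}"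
        by (auto simp: Prin_altdef)
      obtain n g where g: "0 < n" "nmult n q = to_divhull g"
        using ex_nmult_divhull by blast
      have "g \<noteq> 0"
        using g q(1) nmult_eq_iff [of n q 0] by (auto simp: to_divhull_0)
      have "convex_subgroup hull {q} = convex_subgroup hull {nmult n q}"
        using g(1) nmult_convex_subgroup_iff [OF convex_subgroup_hull g(1)]
        by (intro order_antisym hull_minimal convex_subgroup_hull) (auto intro: hull_inc)
      then have "c = prin_hull (convex_subgroup hull {g})"
        using q g by (simp add: prin_hull_hull)
      then show "c \<in> prin_hull ` Prin"
        using \<open>g \<noteq> 0\<close> by (auto simp: Prin_altdef)
    qed
  qed
qed

definition prin_hull_star :: "'g::linordered_ab_group_add set \<Rightarrow> 'g divhull set" where
  "prin_hull_star i = (GREATEST C. convex_subgroup C \<and> C \<subset> prin_hull i)"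

lemma prin_hull_star:
  fixes i :: "'g::linordered_ab_group_add set"
  assumes "i \<in> Prin"
  shows "convex_subgroup (prin_hull_star i)" "prin_hull_star i \<subset> prin_hull i"
    and "convex_subgroup C \<Longrightarrow> C \<subset> prin_hull i \<Longrightarrow> C \<subseteq> prin_hull_star i"
proof -
  define \<C> where "\<C> = {C. convex_subgroup C \<and> C \<subset> prin_hull i}"
  have "prin_hull i \<in> Prin"
    using assms bij_betw_prin_hull by (auto simp: bij_betw_def)
  then obtain q where q: "q \<noteq> 0" "prin_hull i = convex_subgroup hull {q}"
    by (auto simp: Prin_altdef)
  have mem: "C \<in> \<C> \<longleftrightarrow> convex_subgroup C \<and> C \<subseteq> prin_hull i \<and> q \<notin> C" for C
    unfolding \<C>_def q(2) using hull_minimal [of "{q}" C convex_subgroup] hull_inc [of q "{q}"]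
    by auto
  have zero: "{0} \<in> \<C>"
    using q(1) convex_subgroup_hull [of "{q}"]
    by (auto simp: mem convex_subgroup_singleton_0 q(2) convex_subgroup_def)
  have pair: "\<exists>C\<in>\<C>. x \<in> C \<and> y \<in> C" if "x \<in> \<Union>\<C>" "y \<in> \<Union>\<C>" for x y
  proof -
    from that obtain A B where "A \<in> \<C>" "B \<in> \<C>" "x \<in> A" "y \<in> B" by blast
    moreover have "A \<subseteq> B \<or> B \<subseteq> A"
      using calculation by (auto simp: mem dest: convex_subgroup_linear)
    ultimately show ?thesis by blast
  qed
  have "convex_subgroup (\<Union>\<C>)"
    unfolding convex_subgroup_def
  proof (intro conjI ballI)
    show "0 \<in> \<Union>\<C>"
      using zero by blast
    fix x y assume "x \<in> \<Union>\<C>" "y \<in> \<Union>\<C>"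
    then obtain C where C: "C \<in> \<C>" "x \<in> C" "y \<in> C"
      using pair by blast
    then have "x - y \<in> C" "{x..y} \<subseteq> C"
      by (auto simp: mem convex_subgroup_def)
    with C(1) show "x - y \<in> \<Union>\<C>" "{x..y} \<subseteq> \<Union>\<C>"
      by blast+
  qed
  then have max: "\<Union>\<C> \<in> \<C>"
    by (auto simp: mem)
  then have eq: "prin_hull_star i = \<Union>\<C>"
    unfolding prin_hull_star_def by (intro Greatest_equality) (auto simp: \<C>_def)
  show "convex_subgroup (prin_hull_star i)" "prin_hull_star i \<subset> prin_hull i"
    using max unfolding eq \<C>_def by auto
  show "C \<subseteq> prin_hull_star i" if "convex_subgroup C" "C \<subset> prin_hull i"
    using that unfolding eq \<C>_def by blast
qed

text \<open>Elements of \<open>prin_hull i / prin_hull_star i\<close> are cosets, which are added elementwise.\<close>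

definition prin_quot :: "'g::linordered_ab_group_add set \<Rightarrow> 'g divhull set set" where
  "prin_quot i = {x +o prin_hull_star i |x. x \<in> prin_hull i}"

definition coset_less :: "'a::linordered_ab_group_add set \<Rightarrow> 'a set \<Rightarrow> bool" where
  "coset_less A B \<longleftrightarrow> A \<noteq> B \<and> (\<exists>a\<in>A. \<exists>b\<in>B. a < b)"

definition quot_embedding :: "'g::linordered_ab_group_add set \<Rightarrow> ('g divhull set \<Rightarrow> real) \<Rightarrow> bool" where
  "quot_embedding i e \<longleftrightarrow>
    (\<forall>A\<in>prin_quot i. \<forall>B\<in>prin_quot i. e (A + B) = e A + e B) \<and>
    (\<forall>A\<in>prin_quot i. \<forall>B\<in>prin_quot i. coset_less A B \<longrightarrow> e A < e B)"

text \<open>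
  The Hahn product of the quotients. Its elements are functions of which only the values on \<open>Prin\<close>
  matter; the zero of \<open>prin_quot i\<close> is the coset \<open>prin_hull_star i\<close>.
\<close>

definition quot_product :: "('g::linordered_ab_group_add set \<Rightarrow> 'g divhull set) set" where
  "quot_product = {f. (\<forall>i\<in>Prin. f i \<in> prin_quot i) \<and> wfp_on {i\<in>Prin. f i \<noteq> prin_hull_star i} (\<lambda>i j. j \<subset> i)}"

definition quot_product_less ::
  "('g::linordered_ab_group_add set \<Rightarrow> 'g divhull set) \<Rightarrow> ('g set \<Rightarrow> 'g divhull set) \<Rightarrow> bool" where
  "quot_product_less f g \<longleftrightarrow>
    (\<exists>i\<in>Prin. coset_less (f i) (g i) \<and> (\<forall>j\<in>Prin. i \<subset> j \<longrightarrow> f j = g j))"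

definition immediate_embedding ::
  "('g::linordered_ab_group_add divhull \<Rightarrow> 'g set \<Rightarrow> 'g divhull set) \<Rightarrow> bool" where
  "immediate_embedding \<Phi> \<longleftrightarrow>
    (\<forall>x. \<Phi> x \<in> quot_product) \<and>
    (\<forall>x y. \<forall>i\<in>Prin. \<Phi> (x + y) i = \<Phi> x i + \<Phi> y i) \<and>
    (\<forall>x y. x < y \<longrightarrow> quot_product_less (\<Phi> x) (\<Phi> y)) \<and>
    (\<forall>x. \<forall>i\<in>Prin. convex_subgroup hull {x} = prin_hull i \<longrightarrow>
      (\<forall>j\<in>Prin. i \<subset> j \<longrightarrow> \<Phi> x j = prin_hull_star j) \<and> \<Phi> x i = x +o prin_hull_star i)"

text \<open>
  The resulting inclusion of the divisible hull into the real Hahn product over \<open>I\<close>, extended by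
  zero to the extended index set, and its restriction to the given group.
\<close>

definition hull_incl ::
  "('g::linordered_ab_group_add set \<Rightarrow> 'g divhull set \<Rightarrow> real) \<Rightarrow>
    ('g divhull \<Rightarrow> 'g set \<Rightarrow> 'g divhull set) \<Rightarrow> 'g divhull \<Rightarrow> 'g ext_index hahn" where
  "hull_incl e \<Phi> x =
    Abs_hahn (\<lambda>p. case Rep_ext_index p of Pt i \<Rightarrow> e i (\<Phi> x i) | Cut S \<Rightarrow> 0)"

lemma prin_hull_star_quot:
  assumes "i \<in> Prin"
  shows "prin_hull_star i \<in> prin_quot i" "prin_hull_star i + prin_hull_star i = prin_hull_star i"
proof -
  note * = prin_hull_star(1) [OF assms, unfolded convex_subgroup_def]
  have "0 \<in> prin_hull i"
    using prin_hull_star(1,2) [OF assms] by (auto simp: convex_subgroup_def)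
  then show "prin_hull_star i \<in> prin_quot i"
    unfolding prin_quot_def by (force simp: elt_set_plus_def)
  have "x + y \<in> prin_hull_star i" if "x \<in> prin_hull_star i" "y \<in> prin_hull_star i" for x y
    using that convex_subgroup_uminus [OF prin_hull_star(1) [OF assms]] * by (metis diff_minus_eq_add)
  moreover have "x \<in> prin_hull_star i + prin_hull_star i" if "x \<in> prin_hull_star i" for x
    using that * set_plus_intro [of x _ 0] by fastforce
  ultimately show "prin_hull_star i + prin_hull_star i = prin_hull_star i"
    by (auto elim!: set_plus_elim)
qed

lemma
  assumes e: "\<And>i. i \<in> Prin \<Longrightarrow> quot_embedding i (e i)" and \<Phi>: "immediate_embedding \<Phi>"
  shows coord_hull_incl:
      "coord (hull_incl e \<Phi> x) p = (case Rep_ext_index p of Pt i \<Rightarrow> e i (\<Phi> x i) | Cut S \<Rightarrow> 0)"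
    and hull_incl_supported: "hull_incl e \<Phi> x \<in> supported_on idx"
    and hull_incl_add: "hull_incl e \<Phi> (x + y) = hull_incl e \<Phi> x + hull_incl e \<Phi> y"
    and hull_incl_less_iff: "hull_incl e \<Phi> x < hull_incl e \<Phi> y \<longleftrightarrow> x < y"
proof -
  let ?c = "\<lambda>x p. case Rep_ext_index p of Pt i \<Rightarrow> e i (\<Phi> x i) | Cut S \<Rightarrow> 0"
  have Pt: "i \<in> Prin" if "Rep_ext_index p = Pt i" for p and i :: "'a set"
    using Rep_ext_index [of p] that by auto
  have quot: "\<Phi> x i \<in> prin_quot i" if "i \<in> Prin" for x i
    using \<Phi> that by (auto simp: immediate_embedding_def quot_product_def)
  have zero: "e i (prin_hull_star i) = 0" if "i \<in> Prin" for i
    using e [OF that] prin_hull_star_quot [OF that] unfolding quot_embedding_def by force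
  have wf: "wfp_on {p. ?c x p \<noteq> 0} (<)" for x
  proof -
    let ?f = "\<lambda>p. case Rep_ext_index p of Pt i \<Rightarrow> i"
    have wf: "wfp_on {i\<in>Prin. \<Phi> x i \<noteq> prin_hull_star i} (\<lambda>i j. j \<subset> i)"
      using \<Phi> by (auto simp: immediate_embedding_def quot_product_def)
    have sub: "?f ` {p. ?c x p \<noteq> 0} \<subseteq> {i\<in>Prin. \<Phi> x i \<noteq> prin_hull_star i}"
      using zero Pt by (auto split: cut_point.splits)
    show ?thesis
    proof (rule wfp_on_if_convertible_to_wfp_on [OF wfp_on_subset [OF wf sub]])
      fix p q assume "p \<in> {p. ?c x p \<noteq> 0}" "q \<in> {p. ?c x p \<noteq> 0}" "p < q"
      then show "?f q \<subset> ?f p"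
        by (auto simp: less_ext_index_def less_eq_ext_index.rep_eq split: cut_point.splits)
    qed
  qed
  show coord: "coord (hull_incl e \<Phi> x) p = ?c x p" for x p
    unfolding hull_incl_def using wf [of x] by (subst Abs_hahn_inverse) auto
  show "hull_incl e \<Phi> x \<in> supported_on idx"
    unfolding supported_on_def idx_def
  proof (intro CollectI subsetI)
    fix p assume "p \<in> {p. coord (hull_incl e \<Phi> x) p \<noteq> 0}"
    then show "Rep_ext_index p \<in> Pt ` Prin"
      using Pt by (cases "Rep_ext_index p") (auto simp: coord)
  qed
  show "hull_incl e \<Phi> (x + y) = hull_incl e \<Phi> x + hull_incl e \<Phi> y"
  proof -
    have "e i (\<Phi> (x + y) i) = e i (\<Phi> x i) + e i (\<Phi> y i)" if "i \<in> Prin" for i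
      using e [OF that] \<Phi> that quot [OF that] by (simp add: immediate_embedding_def quot_embedding_def)
    then have "coord (hull_incl e \<Phi> (x + y)) = coord (hull_incl e \<Phi> x + hull_incl e \<Phi> y)"
      using Pt by (auto simp: fun_eq_iff plus_hahn.rep_eq coord split: cut_point.splits)
    then show ?thesis
      by (simp add: coord_inject)
  qed
  have mono: "hull_incl e \<Phi> x < hull_incl e \<Phi> y" if "x < y" for x y
  proof -
    have "quot_product_less (\<Phi> x) (\<Phi> y)"
      using \<Phi> that unfolding immediate_embedding_def by blast
    then obtain i where i: "i \<in> Prin" "coset_less (\<Phi> x i) (\<Phi> y i)"
        "\<And>j. j \<in> Prin \<Longrightarrow> i \<subset> j \<Longrightarrow> \<Phi> x j = \<Phi> y j"
      unfolding quot_product_less_def by blast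
    let ?p = "Abs_ext_index (Pt i)"
    have p: "Rep_ext_index ?p = Pt i"
      using i(1) by (intro Abs_ext_index_inverse) auto
    have "?c x ?p < ?c y ?p"
      using e [OF i(1)] i(2) quot [OF i(1)] by (simp add: p quot_embedding_def)
    moreover have "?c x k = ?c y k" if "k < ?p" for k
    proof (cases "Rep_ext_index k")
      case (Pt j)
      then have "i \<subset> j"
        using \<open>k < ?p\<close> by (auto simp: less_ext_index_def less_eq_ext_index.rep_eq p)
      then show ?thesis
        using i(3) [of j] \<open>\<And>p i. Rep_ext_index p = Pt i \<Longrightarrow> i \<in> Prin\<close> [OF Pt] by (simp add: Pt)
    qed simp
    ultimately show ?thesis
      unfolding less_hahn.rep_eq coord by blast
  qed
  then have "strict_mono (hull_incl e \<Phi>)"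
    by (rule strict_monoI)
  then show "hull_incl e \<Phi> x < hull_incl e \<Phi> y \<longleftrightarrow> x < y"
    by (rule strict_mono_less)
qed

definition group_incl ::
  "('g::linordered_ab_group_add set \<Rightarrow> 'g divhull set \<Rightarrow> real) \<Rightarrow>
    ('g divhull \<Rightarrow> 'g set \<Rightarrow> 'g divhull set) \<Rightarrow> 'g \<Rightarrow> 'g ext_index hahn" where
  "group_incl e \<Phi> g = hull_incl e \<Phi> (to_divhull g)"


section \<open>Isomorphisms of ordered groups\<close>

definition ordered_group_iso ::
  "('a::linordered_ab_group_add \<Rightarrow> 'b::linordered_ab_group_add) \<Rightarrow> 'a set \<Rightarrow> 'b set \<Rightarrow> bool" where
  "ordered_group_iso \<phi> A B \<longleftrightarrow>
    bij_betw \<phi> A B \<and> (\<forall>x\<in>A. \<forall>y\<in>A. \<phi> (x + y) = \<phi> x + \<phi> y) \<and> strict_mono_on A \<phi>"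

definition sme_equiv :: "'a::linordered_ab_group_add set \<Rightarrow> 'a \<Rightarrow> 'a \<Rightarrow> bool" where
  "sme_equiv G \<beta> \<gamma> \<longleftrightarrow>
    (\<exists>\<phi>. ordered_group_iso \<phi> (group_closure (insert \<beta> G)) (group_closure (insert \<gamma> G)) \<and>
      (\<forall>g\<in>G. \<phi> g = g) \<and> \<phi> \<beta> = \<gamma>)"


section \<open>Valuations\<close>

datatype 'a ext_val = Fin 'a | Infty

instantiation ext_val :: (linordered_ab_group_add) "{linorder, comm_monoid_add}"
begin

definition zero_ext_val :: "'a ext_val" where
  "zero_ext_val = Fin 0"

fun plus_ext_val :: "'a ext_val \<Rightarrow> 'a ext_val \<Rightarrow> 'a ext_val" where
  "Fin a + Fin b = Fin (a + b)"
| "Infty + b = Infty"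
| "a + Infty = Infty"

fun less_eq_ext_val :: "'a ext_val \<Rightarrow> 'a ext_val \<Rightarrow> bool" where
  "a \<le> Infty \<longleftrightarrow> True"
| "Infty \<le> Fin b \<longleftrightarrow> False"
| "Fin a \<le> Fin b \<longleftrightarrow> a \<le> b"

definition less_ext_val :: "'a ext_val \<Rightarrow> 'a ext_val \<Rightarrow> bool" where
  "less_ext_val a b \<longleftrightarrow> a \<le> b \<and> \<not> b \<le> a"

instance
proof
  fix a b c :: "'a ext_val"
  show "a + b + c = a + (b + c)" by (cases a; cases b; cases c) (simp_all add: ac_simps)
  show "a + b = b + a" by (cases a; cases b) (simp_all add: ac_simps)
  show "0 + a = a" by (cases a) (simp_all add: zero_ext_val_def)
  show "a < b \<longleftrightarrow> a \<le> b \<and> \<not> b \<le> a" by (rule less_ext_val_def)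
  show "a \<le> a" by (cases a) simp_all
  show "a \<le> b \<Longrightarrow> b \<le> c \<Longrightarrow> a \<le> c" by (cases a; cases b; cases c) simp_all
  show "a \<le> b \<Longrightarrow> b \<le> a \<Longrightarrow> a = b" by (cases a; cases b) simp_all
  show "a \<le> b \<or> b \<le> a" by (cases a; cases b) auto
qed

end

definition valuation :: "('a::comm_ring_1 \<Rightarrow> 'l::linordered_ab_group_add ext_val) \<Rightarrow> bool" where
  "valuation \<mu> \<longleftrightarrow>
    \<mu> 1 = Fin 0 \<and> \<mu> 0 = Infty \<and>
    (\<forall>a b. \<mu> (a * b) = \<mu> a + \<mu> b) \<and>
    (\<forall>a b. min (\<mu> a) (\<mu> b) \<le> \<mu> (a + b))"

definition value_group :: "('a::comm_ring_1 \<Rightarrow> 'l::linordered_ab_group_add ext_val) \<Rightarrow> 'l set" where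
  "value_group \<mu> = group_closure {g. Fin g \<in> range \<mu>}"

definition valuation_equiv ::
  "('a::comm_ring_1 \<Rightarrow> 'l::linordered_ab_group_add ext_val) \<Rightarrow>
    ('a \<Rightarrow> 'm::linordered_ab_group_add ext_val) \<Rightarrow> bool" where
  "valuation_equiv \<mu> \<nu> \<longleftrightarrow>
    (\<exists>\<phi>. ordered_group_iso \<phi> (value_group \<mu>) (value_group \<nu>) \<and>
      (\<forall>f. \<nu> f = map_ext_val \<phi> (\<mu> f)))"

text \<open>
  The coefficients of the expansion of \<open>f\<close> in powers of \<open>x - a\<close> are those of \<open>f(x + a)\<close>.
\<close>

definition taylor_coeff :: "'k::field \<Rightarrow> 'k poly \<Rightarrow> nat \<Rightarrow> 'k" where
  "taylor_coeff a f s = coeff (f \<circ>\<^sub>p [:a, 1:]) s"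

lemma pcompose_power: "(p ^ n) \<circ>\<^sub>p q = (p \<circ>\<^sub>p q) ^ n" for q :: "'k::comm_ring_1 poly"
  by (induction n) (auto simp: pcompose_mult pcompose_1)

lemma taylor_expansion: "f = (\<Sum>s\<le>degree f. smult (taylor_coeff a f s) ([:- a, 1:] ^ s))"
proof -
  let ?g = "f \<circ>\<^sub>p [:a, 1:]"
  have "f = ?g \<circ>\<^sub>p [:- a, 1:]"
    by (simp add: pcompose_assoc [symmetric] pcompose_pCons pcompose_idR)
  also have "\<dots> = (\<Sum>s\<le>degree ?g. smult (coeff ?g s) ([:0, 1:] ^ s)) \<circ>\<^sub>p [:- a, 1:]"
    by (simp add: poly_as_sum_of_monoms monom_altdef [symmetric])
  also have "\<dots> = (\<Sum>s\<le>degree f. smult (coeff ?g s) ([:- a, 1:] ^ s))"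
    by (simp add: pcompose_sum pcompose_smult pcompose_power degree_pcompose pcompose_pCons)
  finally show ?thesis
    by (simp add: taylor_coeff_def)
qed

text \<open>
  The embedding \<open>\<iota>\<close> places the values of \<open>v\<close> into the group containing \<open>\<delta>\<close>. Coefficients beyond
  the degree vanish, hence they have value \<open>Infty\<close> and do not affect the minimum.
\<close>

definition depth_zero ::
  "('g \<Rightarrow> 'l::linordered_ab_group_add) \<Rightarrow> ('k::field \<Rightarrow> 'g ext_val) \<Rightarrow> 'k \<Rightarrow> 'l \<Rightarrow>
    'k poly \<Rightarrow> 'l ext_val" where
  "depth_zero \<iota> v a \<delta> f =
    (MIN s\<in>{..degree f}. map_ext_val \<iota> (v (taylor_coeff a f s)) + Fin (nmult s \<delta>))"

end

theory Submission
  imports Defs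
begin

text \<open>
  Each value of \<open>\<omega>\<^sub>a\<^sub>,\<^sub>\<delta>\<close> has the form \<open>\<gamma> + s \<delta>\<close>; constants attain every \<open>\<gamma> \<in> \<Gamma>\<close>, and \<open>x - a\<close> attains
  \<open>\<delta>\<close>. So the value group is \<open>\<langle>\<Gamma>, \<delta>\<rangle>\<close>, and evaluation at constants and at \<open>x - a\<close> shows that an
  equivalence fixes \<open>\<Gamma>\<close> and sends \<open>\<delta>\<close> to \<open>\<epsilon>\<close>. Conversely, an order isomorphism commutes with
  minima.
\<close>

lemma group_closure_minimal:
  assumes "A \<subseteq> group_closure B"
  shows "group_closure A \<subseteq> group_closure B"
proof
  fix x assume "x \<in> group_closure A"
  then show "x \<in> group_closure B"
    by induction (use assms in \<open>auto intro: group_closure.diff\<close>)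
qed

lemma group_closure_nmult: "x \<in> group_closure A \<Longrightarrow> nmult n x \<in> group_closure A"
  by (induction n) (auto intro: group_closure_add)

text \<open>An isomorphism of value groups is controlled only on its domain, so the arguments are
  confined to \<open>A\<close> through \<open>set_ext_val\<close>. This set is empty for
  \<open>Infty\<close>, which makes the condition vacuous there.\<close>

lemma strict_mono_on_map_ext_val:
  fixes \<phi> :: "'a::linordered_ab_group_add \<Rightarrow> 'b::linordered_ab_group_add"
  assumes "strict_mono_on A \<phi>" "set_ext_val x \<subseteq> A" "set_ext_val y \<subseteq> A" "x \<le> y"
  shows "map_ext_val \<phi> x \<le> map_ext_val \<phi> y"
  using assms by (cases x; cases y) (auto simp: strict_mono_on_leD)

lemma depth_zero_const:
  assumes "\<iota> 0 = 0"
  shows "depth_zero \<iota> v a \<delta> [:c:] = map_ext_val \<iota> (v c)"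
  by (cases "v c") (simp_all add: depth_zero_def taylor_coeff_def)

lemma depth_zero_linear:
  assumes "\<iota> 0 = 0" "v 0 = Infty" "v 1 = Fin 0"
  shows "depth_zero \<iota> v a \<delta> [:- a, 1:] = Fin \<delta>"
proof -
  \<comment> \<open>The coefficient 0 contributes \<open>Infty\<close>, and the coefficient 1
    contributes \<open>\<iota> 0 + \<delta> = \<delta>\<close>, which is therefore the
    minimum.\<close>
  have "taylor_coeff a [:- a, 1:] 0 = 0" "taylor_coeff a [:- a, 1:] (Suc 0) = 1"
    by (simp_all add: taylor_coeff_def pcompose_pCons)
  moreover have "{..degree [:- a, 1:]} = {0, Suc 0}"
    by auto
  ultimately show ?thesis
    using assms by (simp add: depth_zero_def min_def)
qed

text \<open>This has literally the shape of the groups in \<open>sme_equiv\<close>, so isomorphisms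
  pass between the two notions unchanged.\<close>

abbreviation depth_zero_group ::
  "('g \<Rightarrow> 'l::linordered_ab_group_add) \<Rightarrow> 'l \<Rightarrow> 'l set" where
  "depth_zero_group \<iota> \<delta> \<equiv> group_closure (insert \<delta> (range \<iota>))"

lemma set_depth_zero_term:
  "set_ext_val (map_ext_val \<iota> y + Fin (nmult s \<delta>)) \<subseteq> depth_zero_group \<iota> \<delta>"
  by (cases y) (auto intro!: group_closure_add group_closure_nmult intro: group_closure.base)

lemma set_depth_zero: "set_ext_val (depth_zero \<iota> v a \<delta> f) \<subseteq> depth_zero_group \<iota> \<delta>"
proof -
  \<comment> \<open>A minimum over a finite nonempty set is attained, so it inherits what holds for
    every single term.\<close>
  have "depth_zero \<iota> v a \<delta> f
      \<in> (\<lambda>s. map_ext_val \<iota> (v (taylor_coeff a f s)) + Fin (nmult s \<delta>)) ` {..degree f}"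
    unfolding depth_zero_def by (rule Min_in) auto
  then show ?thesis
    using set_depth_zero_term by fastforce
qed

lemma value_group_depth_zero:
  assumes "\<iota> 0 = 0" "v 0 = Infty" "v 1 = Fin 0" "range Fin \<subseteq> range v"
  shows "value_group (depth_zero \<iota> v a \<delta>) = depth_zero_group \<iota> \<delta>"
proof
  show "value_group (depth_zero \<iota> v a \<delta>) \<subseteq> depth_zero_group \<iota> \<delta>"
    unfolding value_group_def
  proof (intro group_closure_minimal subsetI)
    fix g assume "g \<in> {g. Fin g \<in> range (depth_zero \<iota> v a \<delta>)}"
    then obtain f where "depth_zero \<iota> v a \<delta> f = Fin g"
      by force
    with set_depth_zero [of \<iota> v a \<delta> f] show "g \<in> depth_zero_group \<iota> \<delta>"
      by simp
  qed
  have "Fin (\<iota> g) \<in> range (depth_zero \<iota> v a \<delta>)" for g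
  proof -
    obtain c where "v c = Fin g"
      using assms(4) by (metis imageE rangeI subsetD)
    then show ?thesis
      using depth_zero_const [of \<iota> v a \<delta> c] assms(1) by (metis ext_val.map(1) rangeI)
  qed
  moreover have "Fin \<delta> \<in> range (depth_zero \<iota> v a \<delta>)"
    using depth_zero_linear [of \<iota> v a \<delta>] assms(1-3) by (metis rangeI)
  ultimately show "depth_zero_group \<iota> \<delta> \<subseteq> value_group (depth_zero \<iota> v a \<delta>)"
    unfolding value_group_def by (intro group_closure_minimal) (auto intro: group_closure.base)
qed

text \<open>Additivity carries each term \<open>\<gamma> + s \<delta>\<close> to
  \<open>\<gamma> + s \<phi>(\<delta>)\<close>. All finite terms lie in the group on which
  \<open>\<phi>\<close> is strictly increasing, so the least term goes to the least term.\<close>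

lemma depth_zero_map:
  fixes \<iota> :: "'g \<Rightarrow> 'l::linordered_ab_group_add"
  assumes iso: "ordered_group_iso \<phi> (depth_zero_group \<iota> \<delta>) B"
    and fix_range: "\<And>g. \<phi> (\<iota> g) = \<iota> g"
  shows "depth_zero \<iota> v a (\<phi> \<delta>) f = map_ext_val \<phi> (depth_zero \<iota> v a \<delta> f)"
proof -
  let ?G = "depth_zero_group \<iota> \<delta>"
  let ?t = "\<lambda>\<delta> s. map_ext_val \<iota> (v (taylor_coeff a f s)) + Fin (nmult s \<delta>)"
  have add: "\<phi> (x + y) = \<phi> x + \<phi> y" if "x \<in> ?G" "y \<in> ?G" for x y
    using iso that by (simp add: ordered_group_iso_def)
  have mono: "strict_mono_on ?G \<phi>"
    using iso by (simp add: ordered_group_iso_def)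
  have \<delta>: "\<delta> \<in> ?G" and \<iota>: "\<iota> g \<in> ?G" for g
    by (auto intro: group_closure.base)
  \<comment> \<open>Cancellation in \<open>\<phi> 0 = \<phi> 0 + \<phi> 0\<close>; this starts the
    induction on multiples of \<open>\<delta>\<close>.\<close>
  have "\<phi> 0 = 0"
    using add [of 0 0] by simp
  then have "\<phi> (nmult s \<delta>) = nmult s (\<phi> \<delta>)" for s
    by (induction s) (simp_all add: add \<delta> group_closure_nmult)
  \<comment> \<open>A coefficient of infinite value gives \<open>Infty\<close> on both sides;
    otherwise additivity applies to \<open>\<iota> g\<close> and the multiple of
    \<open>\<delta>\<close>, both in the group.\<close>
  then have t: "map_ext_val \<phi> (?t \<delta> s) = ?t (\<phi> \<delta>) s" for s
    by (cases "v (taylor_coeff a f s)") (simp_all add: add \<iota> \<delta> group_closure_nmult fix_range)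
  have Min_in: "depth_zero \<iota> v a \<delta> f \<in> ?t \<delta> ` {..degree f}"
    unfolding depth_zero_def by (rule Min_in) auto
  have Min_le: "depth_zero \<iota> v a \<delta> f \<le> ?t \<delta> s" if "s \<le> degree f" for s
    unfolding depth_zero_def using that by (intro Min_le) auto
  have "Min (?t (\<phi> \<delta>) ` {..degree f}) = map_ext_val \<phi> (depth_zero \<iota> v a \<delta> f)"
  proof (rule Min_eqI)
    show "map_ext_val \<phi> (depth_zero \<iota> v a \<delta> f) \<in> ?t (\<phi> \<delta>) ` {..degree f}"
      using Min_in by (auto simp: t)
    fix y assume "y \<in> ?t (\<phi> \<delta>) ` {..degree f}"
    then obtain s where "s \<le> degree f" and y: "y = map_ext_val \<phi> (?t \<delta> s)"
      by (auto simp: t)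
    then show "map_ext_val \<phi> (depth_zero \<iota> v a \<delta> f) \<le> y"
      unfolding y by (intro strict_mono_on_map_ext_val [OF mono] set_depth_zero
          set_depth_zero_term Min_le)
  qed simp
  then show ?thesis
    by (simp add: depth_zero_def)
qed

text \<open>By \<open>value_group_depth_zero\<close> both sides ask for an isomorphism between the
  same two groups, so one and the same \<open>\<phi>\<close> serves in both directions.\<close>

lemma valuation_equiv_depth_zero_iff:
  fixes \<iota> :: "'g::linordered_ab_group_add \<Rightarrow> 'l::linordered_ab_group_add"
  assumes \<iota>: "\<iota> 0 = 0" and v: "v 0 = Infty" "v 1 = Fin 0" "range Fin \<subseteq> range v"
  shows "valuation_equiv (depth_zero \<iota> v a \<delta>) (depth_zero \<iota> v a \<epsilon>) \<longleftrightarrow> sme_equiv (range \<iota>) \<delta> \<epsilon>"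
proof
  assume "valuation_equiv (depth_zero \<iota> v a \<delta>) (depth_zero \<iota> v a \<epsilon>)"
  then obtain \<phi> where iso: "ordered_group_iso \<phi> (depth_zero_group \<iota> \<delta>) (depth_zero_group \<iota> \<epsilon>)"
    and \<phi>: "\<And>f. depth_zero \<iota> v a \<epsilon> f = map_ext_val \<phi> (depth_zero \<iota> v a \<delta> f)"
    by (auto simp: valuation_equiv_def value_group_depth_zero assms)
  have "\<phi> \<delta> = \<epsilon>"
    using \<phi> [of "[:- a, 1:]"] by (simp add: depth_zero_linear assms)
  moreover have "\<phi> (\<iota> g) = \<iota> g" for g
  proof -
    obtain c where "v c = Fin g"
      using v(3) by (metis imageE rangeI subsetD)
    \<comment> \<open>The constant \<open>c\<close> has value \<open>\<iota> g\<close> under both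
      valuations, so compatibility with \<open>\<phi>\<close> says that \<open>\<iota> g\<close> is
      fixed.\<close>
    then show ?thesis
      using \<phi> [of "[:c:]"] by (simp add: depth_zero_const \<iota>)
  qed
  ultimately show "sme_equiv (range \<iota>) \<delta> \<epsilon>"
    using iso unfolding sme_equiv_def by blast
next
  assume "sme_equiv (range \<iota>) \<delta> \<epsilon>"
  then obtain \<phi> where "ordered_group_iso \<phi> (depth_zero_group \<iota> \<delta>) (depth_zero_group \<iota> \<epsilon>)"
    and "\<And>g. \<phi> (\<iota> g) = \<iota> g" and "\<phi> \<delta> = \<epsilon>"
    by (auto simp: sme_equiv_def)
  then show "valuation_equiv (depth_zero \<iota> v a \<delta>) (depth_zero \<iota> v a \<epsilon>)"
    using depth_zero_map [of \<phi> \<delta> \<iota> _ v a] unfolding valuation_equiv_def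
    by (auto simp: value_group_depth_zero assms)
qed

theorem lemma4p2:
  fixes v :: "'k::field \<Rightarrow> 'g::linordered_ab_group_add ext_val"
    and e :: "'g set \<Rightarrow> 'g divhull set \<Rightarrow> real"
    and \<Phi> :: "'g divhull \<Rightarrow> 'g set \<Rightarrow> 'g divhull set"
    and a :: 'k
    and \<delta> \<epsilon> :: "'g ext_index hahn"
  assumes "valuation v"
    and "v ` (UNIV - {0}) = range Fin"
    and "\<And>i. i \<in> Prin \<Longrightarrow> quot_embedding i (e i)"
    and "immediate_embedding \<Phi>"
    and "\<delta> \<in> (\<Union>S\<in>Init. supported_on (idx_cut S))"
    and "\<epsilon> \<in> (\<Union>S\<in>Init. supported_on (idx_cut S))"
  shows "valuation_equiv (depth_zero (group_incl e \<Phi>) v a \<delta>) (depth_zero (group_incl e \<Phi>) v a \<epsilon>)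
    \<longleftrightarrow> sme_equiv (range (group_incl e \<Phi>)) \<delta> \<epsilon>"
proof (rule valuation_equiv_depth_zero_iff)
  show "group_incl e \<Phi> 0 = 0"
    \<comment> \<open>The image of 0 equals its own double, hence vanishes.\<close>
    using hull_incl_add [OF assms(3,4), of 0 0] by (simp add: group_incl_def to_divhull_0)
  show "v 0 = Infty" "v 1 = Fin 0"
    using assms(1) by (simp_all add: valuation_def)
  show "range Fin \<subseteq> range v"
    using assms(2) by blast
qed

end
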